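(* Let $X$ be a complex manifold and $p,q\ge0$, $k\ge 0$ integers. Complex conjugation of currents induces a well-defined map $$\widehat H^k(X,p,q)\longrightarrow\widehat H^k(X,q,p),\qquad [(a,b,r)]\longmapsto[(\overline b,\overline a,r)],$$ and this map is an isomorphism.
   Context: Let $m=\dim_{\mathbb C}X$. $\mathcal E^{i,j}(X)$ is the space of smooth complex $(i,j)$-forms; $D'^{i,j}(X)$ is the space of currents of bidegree $(i,j)$ (topological dual of compactly supported smooth $(m-i,m-j)$-forms), containing $\mathcal E^{i,j}(X)$ via $\alpha(\beta)=\int_X\alpha\wedge\beta$; $D'^k(X)=\bigoplus_{i+j=k}D'^{i,j}(X)$; $I^k(X)$ is the group of locally integral currents of degree $k$. Let $\pi_p$ (resp. $\pi'_q$) be the projection of $D'^k(X)$ onto $\bigoplus_{i+j=k,\,i<p}D'^{i,j}(X)$ (resp. $\bigoplus_{i+j=k,\,j<q}D'^{i,j}(X)$). Put $D'^k(X,p,q)=\pi_p(D'^k(X))\oplus\pi'_q(D'^k(X))$ with differential $d_{p,q}(a,b)=(\pi_p da,\pi'_q db)$, let $\mathcal E^k(X,p,q)\subset D'^k(X,p,q)$ be the subspace of smooth forms, and let $\Psi_{p,q}:I^k(X)\to D'^k(X,p,q)$, $\Psi_{p,q}(r)=(\pi_p r,\pi'_q r)$. A spark of degree $k$ is $(a,b,r)$ with $(a,b)\in D'^k(X,p,q)$, $r\in I^{k+1}(X)$, $dr=0$ and $d_{p,q}(a,b)=e-\Psi_{p,q}(r)$ for some $e\in\mathcal E^{k+1}(X,p,q)$.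 Sparks $(a,b,r),(a',b',r')$ are equivalent if there are $c\in D'^{k-1}(X,p,q)$, $s\in I^k(X)$ with $(a,b)-(a',b')=d_{p,q}c+\Psi_{p,q}(s)$ and $r-r'=-ds$. $\widehat H^k(X,p,q)$ is the group of equivalence classes. *)

theory Defs
  imports "HOL-Analysis.Analysis" "HOL-Algebra.Group" "HOL-Library.Function_Algebras"
begin

text \<open>
  Coordinate spaces are rendered with a natural number as dimension, so that dimension 0 is
  allowed and real dimensions such as \<^term>\<open>2 * m - k\<close> can be used: a vector is a function on
  \<^typ>\<open>nat\<close> vanishing from the dimension on, with the (product) topology of the function space.
  Vector spaces of forms and currents are sets of functions, normalised to be 0 outside their
  natural domain, with the pointwise operations of \<^theory>\<open>HOL-Library.Function_Algebras\<close>.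
\<close>

section \<open>Calculus in coordinates\<close>

type_synonym cvec = "nat \<Rightarrow> complex"

definition coord_space :: "nat \<Rightarrow> (nat \<Rightarrow> 'b::zero) set"
  where "coord_space n = {x. \<forall>i\<ge>n. x i = 0}"

definition coord_measure :: "nat \<Rightarrow> (nat \<Rightarrow> 'b::euclidean_space) measure"
  where "coord_measure n =
    distr (PiM {..<n} (\<lambda>_. lborel)) borel (\<lambda>x i. if i < n then x i else 0)"

definition unit_vec :: "nat \<Rightarrow> 'b \<Rightarrow> (nat \<Rightarrow> 'b::zero)"
  where "unit_vec l c = (\<lambda>i. if i = l then c else 0)"

text \<open>The line through \<open>z\<close> in the direction of \<open>c\<close> in the \<open>l\<close>-th coordinate; for complex
  coordinates \<open>c = 1\<close> and \<open>c = \<i>\<close> give the real and the imaginary direction.\<close>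

definition coord_line :: "(nat \<Rightarrow> 'b::real_vector) \<Rightarrow> nat \<Rightarrow> 'b \<Rightarrow> real \<Rightarrow> (nat \<Rightarrow> 'b)"
  where "coord_line z l c t = z(l := z l + t *\<^sub>R c)"

definition pderiv_dir ::
    "((nat \<Rightarrow> 'b::real_vector) \<Rightarrow> complex) \<Rightarrow> nat \<Rightarrow> 'b \<Rightarrow> (nat \<Rightarrow> 'b) \<Rightarrow> complex"
  where "pderiv_dir f l c z = vector_derivative (\<lambda>t. f (coord_line z l c t)) (at 0)"

primrec C_diff :: "nat \<Rightarrow> cvec set \<Rightarrow> nat \<Rightarrow> (cvec \<Rightarrow> complex) \<Rightarrow> bool" where
  "C_diff m V 0 f \<longleftrightarrow> continuous_on V f"
| "C_diff m V (Suc r) f \<longleftrightarrow> continuous_on V f \<and>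
     (\<forall>l<m. \<forall>c\<in>{1, \<i>}.
        (\<forall>z\<in>V. (\<lambda>t. f (coord_line z l c t)) differentiable (at 0)) \<and>
        C_diff m V r (pderiv_dir f l c))"

definition smooth_fun :: "nat \<Rightarrow> cvec set \<Rightarrow> (cvec \<Rightarrow> complex) \<Rightarrow> bool"
  where "smooth_fun m V f \<longleftrightarrow> (\<forall>r. C_diff m V r f)"

definition del_z :: "nat \<Rightarrow> (cvec \<Rightarrow> complex) \<Rightarrow> cvec \<Rightarrow> complex"
  where "del_z l f z = (pderiv_dir f l 1 z - \<i> * pderiv_dir f l \<i> z) / 2"

definition del_zbar :: "nat \<Rightarrow> (cvec \<Rightarrow> complex) \<Rightarrow> cvec \<Rightarrow> complex"
  where "del_zbar l f z = (pderiv_dir f l 1 z + \<i> * pderiv_dir f l \<i> z) / 2"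

definition holo_fun :: "nat \<Rightarrow> cvec set \<Rightarrow> (cvec \<Rightarrow> complex) \<Rightarrow> bool"
  where "holo_fun m V f \<longleftrightarrow> smooth_fun m V f \<and> (\<forall>l<m. \<forall>z\<in>V. del_zbar l f z = 0)"


section \<open>Complex manifolds\<close>

type_synonym 'a chart = "'a set \<times> ('a \<Rightarrow> cvec)"

record 'a charted_space =
  pts :: "'a topology"
  cdim :: nat
  atlas :: "'a chart set"

definition chart_image :: "'a chart \<Rightarrow> cvec set"
  where "chart_image c = snd c ` fst c"

definition chart_inv :: "'a chart \<Rightarrow> cvec \<Rightarrow> 'a"
  where "chart_inv c = inv_into (fst c) (snd c)"

definition transition :: "'a chart \<Rightarrow> 'a chart \<Rightarrow> cvec \<Rightarrow> cvec"
  where "transition c d = snd d \<circ> chart_inv c"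

definition complex_manifold :: "'a charted_space \<Rightarrow> bool" where
  "complex_manifold M \<longleftrightarrow>
     Hausdorff_space (pts M) \<and> second_countable (pts M) \<and>
     (\<Union>c\<in>atlas M. fst c) = topspace (pts M) \<and>
     (\<forall>c\<in>atlas M. openin (pts M) (fst c) \<and>
        openin (top_of_set (coord_space (cdim M))) (chart_image c) \<and>
        homeomorphic_map (subtopology (pts M) (fst c)) (top_of_set (chart_image c)) (snd c)) \<and>
     (\<forall>c\<in>atlas M. \<forall>d\<in>atlas M. \<forall>l<cdim M.
        holo_fun (cdim M) (snd c ` (fst c \<inter> fst d)) (\<lambda>z. transition c d z l))"

text \<open>The complex Jacobian of the change of coordinates, applied to a tangent vector.\<close>

definition push_vec :: "'a charted_space \<Rightarrow> 'a chart \<Rightarrow> 'a chart \<Rightarrow> cvec \<Rightarrow> cvec \<Rightarrow> cvec"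
  where "push_vec M c d z v =
    (\<lambda>l. \<Sum>s<cdim M. del_z s (\<lambda>w. transition c d w l) z * v s)"


section \<open>Smooth forms\<close>

text \<open>
  A form is given by its coordinate expressions in all charts of the atlas; a coordinate
  expression assigns to a point and a list of (real) tangent vectors a complex number.
  Wedge products use the determinant convention, without factorials.
\<close>

type_synonym 'a form = "'a chart \<Rightarrow> cvec \<Rightarrow> cvec list \<Rightarrow> complex"

definition covec_wedge :: "(cvec \<Rightarrow> complex) list \<Rightarrow> cvec list \<Rightarrow> complex" where
  "covec_wedge as vs =
     (\<Sum>\<sigma> | \<sigma> permutes {..<length as}.
        of_int (sign \<sigma>) * (\<Prod>r<length as. (as ! r) (vs ! \<sigma> r)))"

definition dz_dzbar :: "nat set \<Rightarrow> nat set \<Rightarrow> cvec list \<Rightarrow> complex" where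
  "dz_dzbar I J =
     covec_wedge (map (\<lambda>l v. v l) (sorted_list_of_set I) @
                  map (\<lambda>l v. cnj (v l)) (sorted_list_of_set J))"

definition local_forms ::
    "nat \<Rightarrow> cvec set \<Rightarrow> nat \<Rightarrow> nat \<Rightarrow> (cvec \<Rightarrow> cvec list \<Rightarrow> complex) set" where
  "local_forms m V i j =
     {\<eta>. \<exists>f. (\<forall>I J. smooth_fun m V (f I J)) \<and>
        \<eta> = (\<lambda>z vs. if z \<in> V \<and> length vs = i + j \<and> set vs \<subseteq> coord_space m
               then \<Sum>I | I \<subseteq> {..<m} \<and> card I = i. \<Sum>J | J \<subseteq> {..<m} \<and> card J = j.
                      f I J z * dz_dzbar I J vs
               else 0)}"

definition forms :: "'a charted_space \<Rightarrow> nat \<Rightarrow> nat \<Rightarrow> 'a form set" where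
  "forms M i j =
     {\<omega>. (\<forall>c. c \<notin> atlas M \<longrightarrow> \<omega> c = 0) \<and>
        (\<forall>c\<in>atlas M. \<omega> c \<in> local_forms (cdim M) (chart_image c) i j) \<and>
        (\<forall>c\<in>atlas M. \<forall>d\<in>atlas M. \<forall>x\<in>fst c \<inter> fst d. \<forall>vs.
           set vs \<subseteq> coord_space (cdim M) \<longrightarrow>
           \<omega> c (snd c x) vs = \<omega> d (snd d x) (map (push_vec M c d (snd c x)) vs))}"

definition form_supp :: "'a charted_space \<Rightarrow> 'a form \<Rightarrow> 'a set" where
  "form_supp M \<omega> =
     pts M closure_of {x \<in> topspace (pts M). \<exists>c\<in>atlas M. x \<in> fst c \<and> \<omega> c (snd c x) \<noteq> 0}"

definition cforms :: "'a charted_space \<Rightarrow> nat \<Rightarrow> nat \<Rightarrow> 'a form set"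
  where "cforms M i j = {\<omega> \<in> forms M i j. compactin (pts M) (form_supp M \<omega>)}"

definition form_scale :: "complex \<Rightarrow> 'a form \<Rightarrow> 'a form"
  where "form_scale s \<omega> = (\<lambda>c z vs. s * \<omega> c z vs)"

definition form_cnj :: "'a form \<Rightarrow> 'a form"
  where "form_cnj \<omega> = (\<lambda>c z vs. cnj (\<omega> c z vs))"

text \<open>
  The operators \<open>\<partial>\<close> and \<open>\<partial>\<close>-bar, with \<open>d = \<partial> + \<partial>\<close>-bar:
  \<open>(\<partial>\<omega>)(v\<^sub>0, \<dots>, v\<^sub>n) = \<Sum>\<^sub>r (-1)^r (\<Sum>\<^sub>l dz\<^sub>l(v\<^sub>r) \<partial>/\<partial>z\<^sub>l) \<omega>(v\<^sub>0, \<dots>, v\<^sub>n without v\<^sub>r)\<close>,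
  that is, \<open>\<partial>(f dz\<^sub>I \<and> d\<close>z-bar\<open>\<^sub>J) = \<Sum>\<^sub>l (\<partial>f/\<partial>z\<^sub>l) dz\<^sub>l \<and> dz\<^sub>I \<and> d\<close>z-bar\<open>\<^sub>J\<close>.
\<close>

definition omit_nth :: "nat \<Rightarrow> 'b list \<Rightarrow> 'b list"
  where "omit_nth r vs = take r vs @ drop (Suc r) vs"

definition form_del :: "'a charted_space \<Rightarrow> 'a form \<Rightarrow> 'a form" where
  "form_del M \<omega> = (\<lambda>c z vs.
     if c \<in> atlas M \<and> z \<in> chart_image c \<and> set vs \<subseteq> coord_space (cdim M)
     then \<Sum>r<length vs. (-1) ^ r *
            (\<Sum>l<cdim M. (vs ! r) l * del_z l (\<lambda>w. \<omega> c w (omit_nth r vs)) z)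
     else 0)"

definition form_delbar :: "'a charted_space \<Rightarrow> 'a form \<Rightarrow> 'a form" where
  "form_delbar M \<omega> = (\<lambda>c z vs.
     if c \<in> atlas M \<and> z \<in> chart_image c \<and> set vs \<subseteq> coord_space (cdim M)
     then \<Sum>r<length vs. (-1) ^ r *
            (\<Sum>l<cdim M. cnj ((vs ! r) l) * del_zbar l (\<lambda>w. \<omega> c w (omit_nth r vs)) z)
     else 0)"

text \<open>Wedge product of a form of degree \<open>a\<close> with a form of degree \<open>b\<close>.\<close>

definition form_wedge :: "nat \<Rightarrow> nat \<Rightarrow> 'a form \<Rightarrow> 'a form \<Rightarrow> 'a form" where
  "form_wedge a b \<alpha> \<beta> = (\<lambda>c z vs.
     if length vs = a + b
     then (\<Sum>\<sigma> | \<sigma> permutes {..<a + b}. of_int (sign \<sigma>) *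
             \<alpha> c z (map (\<lambda>r. vs ! \<sigma> r) [0..<a]) *
             \<beta> c z (map (\<lambda>r. vs ! \<sigma> r) [a..<a + b])) / (fact a * fact b)
     else 0)"

text \<open>Integration of compactly supported forms of top degree, for the orientation
  \<open>x\<^sub>0, y\<^sub>0, x\<^sub>1, y\<^sub>1, \<dots>\<close>: a form is cut into finitely many pieces, each supported in a chart (by
  means of a partition of unity); the value does not depend on the choice of the pieces.\<close>

definition chart_integral :: "'a charted_space \<Rightarrow> 'a chart \<Rightarrow> 'a form \<Rightarrow> complex" where
  "chart_integral M c \<eta> =
     (LINT z : chart_image c | coord_measure (cdim M).
        \<eta> c z (concat (map (\<lambda>l. [unit_vec l 1, unit_vec l \<i>]) [0..<cdim M])))"

definition form_has_integral :: "'a charted_space \<Rightarrow> 'a form \<Rightarrow> complex \<Rightarrow> bool" where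
  "form_has_integral M \<eta> y \<longleftrightarrow>
     (\<exists>(r::nat) cs \<eta>s.
        (\<forall>s<r. cs s \<in> atlas M \<and> \<eta>s s \<in> cforms M (cdim M) (cdim M) \<and>
               form_supp M (\<eta>s s) \<subseteq> fst (cs s)) \<and>
        \<eta> = (\<Sum>s<r. \<eta>s s) \<and> y = (\<Sum>s<r. chart_integral M (cs s) (\<eta>s s)))"


section \<open>Currents\<close>

text \<open>
  The topology on the forms with support in a fixed compact set is given by the seminorms below
  (uniform convergence of all derivatives on compact subsets of charts). A linear functional on
  the compactly supported forms is continuous for the inductive limit topology iff its
  restrictions to these subspaces are continuous.
\<close>

primrec iter_pderiv :: "(nat \<times> complex) list \<Rightarrow> (cvec \<Rightarrow> complex) \<Rightarrow> cvec \<Rightarrow> complex" where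
  "iter_pderiv [] f = f"
| "iter_pderiv (d # ds) f = pderiv_dir (iter_pderiv ds f) (fst d) (snd d)"

definition form_seminorm ::
    "'a charted_space \<Rightarrow> nat \<Rightarrow> 'a chart \<Rightarrow> cvec set \<Rightarrow> 'a form \<Rightarrow> real" where
  "form_seminorm M N c L \<omega> =
     Sup (insert 0 {norm (iter_pderiv ds (\<lambda>w. \<omega> c w vs) z) | ds vs z.
        set ds \<subseteq> {..<cdim M} \<times> {1, \<i>} \<and> length ds \<le> N \<and>
        set vs \<subseteq> {unit_vec l e | l e. l < cdim M \<and> e \<in> {1, \<i>}} \<and> z \<in> L})"

definition form_functional_continuous ::
    "'a charted_space \<Rightarrow> nat \<Rightarrow> nat \<Rightarrow> ('a form \<Rightarrow> complex) \<Rightarrow> bool" where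
  "form_functional_continuous M i j T \<longleftrightarrow>
     (\<forall>K. compactin (pts M) K \<longrightarrow>
        (\<exists>F N C. finite F \<and>
           (\<forall>(c, L)\<in>F. c \<in> atlas M \<and> compact L \<and> L \<subseteq> chart_image c) \<and>
           (\<forall>\<omega>\<in>cforms M i j. form_supp M \<omega> \<subseteq> K \<longrightarrow>
              norm (T \<omega>) \<le> C * (\<Sum>(c, L)\<in>F. form_seminorm M N c L \<omega>))))"

definition form_dual :: "'a charted_space \<Rightarrow> nat \<Rightarrow> nat \<Rightarrow> ('a form \<Rightarrow> complex) set" where
  "form_dual M i j =
     {T. (\<forall>\<omega>. \<omega> \<notin> cforms M i j \<longrightarrow> T \<omega> = 0) \<and>
        (\<forall>\<omega>\<in>cforms M i j. \<forall>\<omega>'\<in>cforms M i j. T (\<omega> + \<omega>') = T \<omega> + T \<omega>') \<and>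
        (\<forall>s. \<forall>\<omega>\<in>cforms M i j. T (form_scale s \<omega>) = s * T \<omega>) \<and>
        form_functional_continuous M i j T}"

definition bidegree_currents :: "'a charted_space \<Rightarrow> nat \<Rightarrow> nat \<Rightarrow> ('a form \<Rightarrow> complex) set"
  where "bidegree_currents M i j =
    (if i \<le> cdim M \<and> j \<le> cdim M then form_dual M (cdim M - i) (cdim M - j) else {0})"

text \<open>An element of the direct sum of all spaces of currents is the family of its components,
  indexed by the bidegree. The degree is an integer since degree \<open>-1\<close> occurs below.\<close>

type_synonym 'a current = "nat \<Rightarrow> nat \<Rightarrow> 'a form \<Rightarrow> complex"

definition currents :: "'a charted_space \<Rightarrow> int \<Rightarrow> 'a current set" where
  "currents M k =
     {T. \<forall>i j. if int i + int j = k then T i j \<in> bidegree_currents M i j else T i j = 0}"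

text \<open>The differential extending the one on smooth forms: \<open>(dT)(\<beta>) = (-1)^(k+1) T(d\<beta>)\<close> for \<open>T\<close> of
  degree \<open>k\<close>; on the component of bidegree \<open>(i, j)\<close> of \<open>dT\<close>, \<open>i + j = k + 1\<close>.\<close>

definition current_d :: "'a charted_space \<Rightarrow> 'a current \<Rightarrow> 'a current" where
  "current_d M T = (\<lambda>i j \<beta>.
     if i \<le> cdim M \<and> j \<le> cdim M \<and> \<beta> \<in> cforms M (cdim M - i) (cdim M - j)
     then (-1) ^ (i + j) * ((if i = 0 then 0 else T (i - 1) j (form_del M \<beta>)) +
                            (if j = 0 then 0 else T i (j - 1) (form_delbar M \<beta>)))
     else 0)"

definition current_cnj :: "'a current \<Rightarrow> 'a current"
  where "current_cnj T = (\<lambda>i j \<beta>. cnj (T j i (form_cnj \<beta>)))"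

definition smooth_currents :: "'a charted_space \<Rightarrow> nat \<Rightarrow> nat \<Rightarrow> ('a form \<Rightarrow> complex) set" where
  "smooth_currents M i j =
     {T \<in> bidegree_currents M i j. \<exists>\<alpha>\<in>forms M i j.
        \<forall>\<beta>\<in>cforms M (cdim M - i) (cdim M - j).
          form_has_integral M
            (form_wedge (i + j) ((cdim M - i) + (cdim M - j)) \<alpha> \<beta>) (T \<beta>)}"


section \<open>Locally integral currents\<close>

definition lipschitz_map :: "nat \<Rightarrow> nat \<Rightarrow> ((nat \<Rightarrow> real) \<Rightarrow> cvec) \<Rightarrow> bool" where
  "lipschitz_map n m g \<longleftrightarrow> g ` coord_space n \<subseteq> coord_space m \<and>
     (\<exists>C. \<forall>x\<in>coord_space n. \<forall>y\<in>coord_space n.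
        L2_set (\<lambda>l. norm (g x l - g y l)) {..<m} \<le> C * L2_set (\<lambda>l. x l - y l) {..<n})"

text \<open>The columns of the Jacobian matrix of a Lipschitz map, which exist almost everywhere.\<close>

definition tangent_vecs :: "nat \<Rightarrow> ((nat \<Rightarrow> real) \<Rightarrow> cvec) \<Rightarrow> (nat \<Rightarrow> real) \<Rightarrow> cvec list"
  where "tangent_vecs n g y = map (\<lambda>s l. pderiv_dir (\<lambda>x. g x l) s 1 y) [0..<n]"

text \<open>Volume of the parallelepiped spanned by real tangent vectors (root of the Gram determinant).\<close>

definition gram_volume :: "nat \<Rightarrow> cvec list \<Rightarrow> real" where
  "gram_volume m vs =
     sqrt (\<Sum>\<sigma> | \<sigma> permutes {..<length vs}.
        of_int (sign \<sigma>) * (\<Prod>r<length vs. \<Sum>l<m. inner ((vs ! r) l) ((vs ! \<sigma> r) l)))"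

text \<open>
  Integer multiplicity locally rectifiable currents of degree \<open>k\<close>, i.e. of dimension
  \<open>n = 2 m - k\<close>: countable sums, of locally finite mass, of integer multiples of images of
  compact subsets \<open>B\<^sub>l\<close> of real \<open>n\<close>-space under Lipschitz maps \<open>g\<^sub>l\<close> into charts \<open>c\<^sub>l\<close>.
  Near a point the mass is measured in any chart \<open>d\<close> around it; the choice of \<open>d\<close> is immaterial.
  For \<open>k > 2 m\<close> no condition remains, and there are no nonzero currents.
\<close>

definition locally_rectifiable :: "'a charted_space \<Rightarrow> nat \<Rightarrow> 'a current \<Rightarrow> bool" where
  "locally_rectifiable M k T \<longleftrightarrow>
     (let m = cdim M; n = 2 * m - k in
      \<exists>(c :: nat \<Rightarrow> 'a chart) (B :: nat \<Rightarrow> (nat \<Rightarrow> real) set) g (\<theta> :: nat \<Rightarrow> int).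
        (\<forall>l. B l \<noteq> {} \<longrightarrow> c l \<in> atlas M \<and> compact (B l) \<and> B l \<subseteq> coord_space n \<and>
             lipschitz_map n m (g l) \<and> g l ` B l \<subseteq> chart_image (c l)) \<and>
        (\<forall>d\<in>atlas M. \<forall>K. compactin (pts M) K \<and> K \<subseteq> fst d \<longrightarrow>
           (\<Sum>l. ennreal (of_int \<bar>\<theta> l\<bar>) *
              (\<integral>\<^sup>+y\<in>{y \<in> B l. chart_inv (c l) (g l y) \<in> K}.
                 ennreal (gram_volume m
                   (map (push_vec M (c l) d (g l y)) (tangent_vecs n (g l) y)))
               \<partial>coord_measure n)) < \<infinity>) \<and>
        (\<forall>i\<le>m. \<forall>j\<le>m. i + j = k \<longrightarrow> (\<forall>\<beta>\<in>cforms M (m - i) (m - j).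
           (\<lambda>l. of_int (\<theta> l) *
              (LINT y : B l | coord_measure n. \<beta> (c l) (g l y) (tangent_vecs n (g l) y)))
           sums T i j \<beta>)))"

definition integral_currents :: "'a charted_space \<Rightarrow> nat \<Rightarrow> 'a current set" where
  "integral_currents M k =
     {T \<in> currents M (int k). locally_rectifiable M k T \<and>
        locally_rectifiable M (Suc k) (current_d M T)}"


section \<open>Spark classes\<close>

definition proj_fst_lt :: "nat \<Rightarrow> 'a current \<Rightarrow> 'a current"
  where "proj_fst_lt p T = (\<lambda>i j. if i < p then T i j else 0)"

definition proj_snd_lt :: "nat \<Rightarrow> 'a current \<Rightarrow> 'a current"
  where "proj_snd_lt q T = (\<lambda>i j. if j < q then T i j else 0)"

definition trunc_currents ::
    "'a charted_space \<Rightarrow> int \<Rightarrow> nat \<Rightarrow> nat \<Rightarrow> ('a current \<times> 'a current) set"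
  where "trunc_currents M k p q =
    (proj_fst_lt p ` currents M k) \<times> (proj_snd_lt q ` currents M k)"

definition trunc_d ::
    "'a charted_space \<Rightarrow> nat \<Rightarrow> nat \<Rightarrow> 'a current \<times> 'a current \<Rightarrow> 'a current \<times> 'a current"
  where "trunc_d M p q = (\<lambda>(a, b). (proj_fst_lt p (current_d M a), proj_snd_lt q (current_d M b)))"

definition trunc_forms ::
    "'a charted_space \<Rightarrow> int \<Rightarrow> nat \<Rightarrow> nat \<Rightarrow> ('a current \<times> 'a current) set"
  where "trunc_forms M k p q =
    {(a, b) \<in> trunc_currents M k p q.
       \<forall>i j. a i j \<in> smooth_currents M i j \<and> b i j \<in> smooth_currents M i j}"

definition Psi :: "nat \<Rightarrow> nat \<Rightarrow> 'a current \<Rightarrow> 'a current \<times> 'a current"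
  where "Psi p q r = (proj_fst_lt p r, proj_snd_lt q r)"

type_synonym 'a spark = "'a current \<times> 'a current \<times> 'a current"

definition sparks :: "'a charted_space \<Rightarrow> nat \<Rightarrow> nat \<Rightarrow> nat \<Rightarrow> 'a spark set" where
  "sparks M k p q =
     {(a, b, r). (a, b) \<in> trunc_currents M (int k) p q \<and>
        r \<in> integral_currents M (k + 1) \<and> current_d M r = 0 \<and>
        (\<exists>e\<in>trunc_forms M (int k + 1) p q. trunc_d M p q (a, b) = e - Psi p q r)}"

definition spark_rel :: "'a charted_space \<Rightarrow> nat \<Rightarrow> nat \<Rightarrow> nat \<Rightarrow> ('a spark \<times> 'a spark) set" where
  "spark_rel M k p q =
     {((a, b, r), (a', b', r')). (a, b, r) \<in> sparks M k p q \<and> (a', b', r') \<in> sparks M k p q \<and>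
        (\<exists>c\<in>trunc_currents M (int k - 1) p q. \<exists>s\<in>integral_currents M k.
           (a, b) - (a', b') = trunc_d M p q c + Psi p q s \<and> r - r' = - current_d M s)}"

definition spark_class :: "'a charted_space \<Rightarrow> nat \<Rightarrow> nat \<Rightarrow> nat \<Rightarrow> 'a spark \<Rightarrow> 'a spark set"
  where "spark_class M k p q x = spark_rel M k p q `` {x}"

definition spark_group :: "'a charted_space \<Rightarrow> nat \<Rightarrow> nat \<Rightarrow> nat \<Rightarrow> 'a spark set monoid" where
  "spark_group M k p q =
     \<lparr>carrier = sparks M k p q // spark_rel M k p q,
      mult = (\<lambda>S S'. \<Union>x\<in>S. \<Union>y\<in>S'. spark_class M k p q (x + y)),
      one = spark_class M k p q 0\<rparr>"

definition spark_cnj :: "'a spark \<Rightarrow> 'a spark"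
  where "spark_cnj = (\<lambda>(a, b, r). (current_cnj b, current_cnj a, r))"

end

theory Submission
  imports Defs
begin

text \<open>
  Conjugation of forms exchanges bidegrees and \<open>\<partial>\<close> with \<open>\<partial>\<close>-bar, hence on currents it is an involution
  commuting with \<open>d\<close> and exchanging the two truncations; it preserves smoothness, and it fixes
  integral currents since these are limits of real multiples of integrals over real sets.
  So conjugation maps sparks to sparks and respects equivalence in both directions, and the
  isomorphism sends a class to its image.
\<close>

section \<open>Smooth functions\<close>

text \<open>\<open>V\<close> is open only relative to \<open>coord_space m\<close>; since
  \<open>l < m\<close>, moving the \<open>l\<close>-th coordinate never leaves
  \<open>coord_space m\<close>, so continuity of the line is enough to stay in \<open>V\<close> near
  \<open>t = 0\<close>.\<close>

lemma coord_line_nbhd: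
  fixes V :: "(nat \<Rightarrow> 'b::real_normed_vector) set"
  assumes "openin (top_of_set (coord_space m)) V" and z: "z \<in> V" and l: "l < m"
  obtains S where "open S" "0 \<in> S" "\<And>t. t \<in> S \<Longrightarrow> coord_line z l c t \<in> V"
proof -
  obtain T where T: "open T" "V = coord_space m \<inter> T"
    using assms(1) by (auto simp: openin_open)
  have "continuous_on UNIV (coord_line z l c)"
    unfolding coord_line_def fun_upd_def
  proof (rule continuous_on_coordinatewise_then_product)
    show "continuous_on UNIV (\<lambda>t. if i = l then z l + t *\<^sub>R c else z i)" for i
      by (cases "i = l") (auto intro!: continuous_intros)
  qed
  then have "open (coord_line z l c -` T)"
    using T(1) by (simp add: open_vimage)
  moreover have "0 \<in> coord_line z l c -` T"
    using z T by (simp add: coord_line_def)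
  moreover have "coord_line z l c t \<in> V" if "t \<in> coord_line z l c -` T" for t
    using that z l T by (auto simp: coord_line_def coord_space_def)
  ultimately show thesis by (rule that)
qed

lemma has_vector_derivative_coord_line_cong:
  fixes f g :: "(nat \<Rightarrow> 'b::real_normed_vector) \<Rightarrow> complex"
  assumes V: "openin (top_of_set (coord_space m)) V" "z \<in> V" "l < m"
    and eq: "\<And>w. w \<in> V \<Longrightarrow> f w = g w"
  shows "((\<lambda>t. f (coord_line z l c t)) has_vector_derivative D) (at 0) \<longleftrightarrow>
         ((\<lambda>t. g (coord_line z l c t)) has_vector_derivative D) (at 0)"
proof -
  obtain S where S: "open S" "0 \<in> S" "\<And>t. t \<in> S \<Longrightarrow> coord_line z l c t \<in> V"
    using coord_line_nbhd[OF V] by blast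
  show ?thesis
    by (rule iffI; erule has_vector_derivative_transform_within_open[OF _ S(1,2)])
      (simp_all add: S(3) eq)
qed

lemma pderiv_dir_cong:
  fixes f g :: "(nat \<Rightarrow> 'b::real_normed_vector) \<Rightarrow> complex"
  assumes "openin (top_of_set (coord_space m)) V" "z \<in> V" "l < m"
    and "\<And>w. w \<in> V \<Longrightarrow> f w = g w"
  shows "pderiv_dir f l c z = pderiv_dir g l c z"
  \<comment> \<open>\<open>vector_derivative\<close> chooses among all \<open>D\<close> that are
    derivatives. Equivalence for every \<open>D\<close> makes the two choices coincide, even where
    no derivative exists.\<close>
  unfolding pderiv_dir_def vector_derivative_def
  using has_vector_derivative_coord_line_cong[OF assms(1-3), of f g] assms(4) by simp

lemma differentiable_coord_line_cong:
  fixes f g :: "(nat \<Rightarrow> 'b::real_normed_vector) \<Rightarrow> complex"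
  assumes "openin (top_of_set (coord_space m)) V" "z \<in> V" "l < m"
    and "\<And>w. w \<in> V \<Longrightarrow> f w = g w"
  shows "(\<lambda>t. f (coord_line z l c t)) differentiable (at 0) \<longleftrightarrow>
         (\<lambda>t. g (coord_line z l c t)) differentiable (at 0)"
  using has_vector_derivative_coord_line_cong[OF assms(1-3), of f g] assms(4)
  by (metis differentiableI_vector vector_derivative_works)

lemma has_vector_derivative_pderiv_dir:
  assumes "(\<lambda>t. f (coord_line z l c t)) differentiable (at 0)"
  shows "((\<lambda>t. f (coord_line z l c t)) has_vector_derivative pderiv_dir f l c z) (at 0)"
  using assms by (simp add: pderiv_dir_def vector_derivative_works)

text \<open>Directions are differentiated along a real parameter, so real-linear maps commute with
  \<open>pderiv_dir\<close>. This covers conjugation, which is not complex-linear.\<close>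

lemma bounded_linear_pderiv_dir:
  assumes "(\<lambda>t. f (coord_line z l c t)) differentiable (at 0)" and "bounded_linear h"
  shows "(\<lambda>t. h (f (coord_line z l c t))) differentiable (at 0)"
    and "pderiv_dir (\<lambda>w. h (f w)) l c z = h (pderiv_dir f l c z)"
proof -
  have "((\<lambda>t. h (f (coord_line z l c t))) has_vector_derivative h (pderiv_dir f l c z)) (at 0)"
    using bounded_linear.has_vector_derivative[OF assms(2) has_vector_derivative_pderiv_dir]
      assms(1) by blast
  then show "(\<lambda>t. h (f (coord_line z l c t))) differentiable (at 0)"
    and "pderiv_dir (\<lambda>w. h (f w)) l c z = h (pderiv_dir f l c z)"
    by (auto simp: pderiv_dir_def intro: differentiableI_vector vector_derivative_at)
qed

lemma pderiv_dir_add: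
  assumes "(\<lambda>t. f (coord_line z l c t)) differentiable (at 0)"
    and "(\<lambda>t. g (coord_line z l c t)) differentiable (at 0)"
  shows "pderiv_dir (\<lambda>w. f w + g w) l c z = pderiv_dir f l c z + pderiv_dir g l c z"
  using has_vector_derivative_add[OF assms[THEN has_vector_derivative_pderiv_dir]]
  by (simp add: pderiv_dir_def vector_derivative_at)

section \<open>Closure properties of smooth functions\<close>

lemma C_diff_cong:
  assumes "openin (top_of_set (coord_space m)) V" and "\<And>w. w \<in> V \<Longrightarrow> f w = g w"
    and "C_diff m V r f"
  shows "C_diff m V r g"
  using assms(2,3)
proof (induction r arbitrary: f g)
  case 0
  then show ?case using continuous_on_cong by fastforce
next
  case (Suc r)
  have cont: "continuous_on V g"
    using Suc.prems continuous_on_cong by fastforce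
  have diff: "(\<lambda>t. g (coord_line z l c t)) differentiable (at 0)"
    if "l < m" "c \<in> {1, \<i>}" "z \<in> V" for l c z
    using that Suc.prems differentiable_coord_line_cong[OF assms(1), of z l f g c] by auto
  have "C_diff m V r (pderiv_dir g l c)" if lc: "l < m" "c \<in> {1, \<i>}" for l c
    using Suc.IH[of "pderiv_dir f l c" "pderiv_dir g l c"]
      pderiv_dir_cong[OF assms(1) _ lc(1) Suc.prems(1)] Suc.prems(2) lc by auto
  then show ?case using cont diff by auto
qed

lemma C_diff_bounded_linear:
  assumes "openin (top_of_set (coord_space m)) V" and h: "bounded_linear h"
    and "C_diff m V r f"
  shows "C_diff m V r (\<lambda>w. h (f w))"
  using assms(3)
proof (induction r arbitrary: f)
  case 0
  then show ?case using bounded_linear.continuous_on[OF h, of V f] by simp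
next
  case (Suc r)
  have cont: "continuous_on V (\<lambda>w. h (f w))"
    using Suc.prems bounded_linear.continuous_on[OF h, of V f] by simp
  have diff: "(\<lambda>t. f (coord_line z l c t)) differentiable (at 0)"
    if "l < m" "c \<in> {1, \<i>}" "z \<in> V" for l c z
    using that Suc.prems by auto
  \<comment> \<open>The derivative of the composite is known to be \<open>h\<close> of the
    derivative only on \<open>V\<close>, where \<open>f\<close> is differentiable; hence the detour
    through \<open>C_diff_cong\<close>.\<close>
  have "C_diff m V r (pderiv_dir (\<lambda>w. h (f w)) l c)" if lc: "l < m" "c \<in> {1, \<i>}" for l c
    by (rule C_diff_cong[OF assms(1) _ Suc.IH[of "pderiv_dir f l c"]])
      (use lc diff h Suc.prems in \<open>auto simp: bounded_linear_pderiv_dir\<close>)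
  moreover have "(\<lambda>t. h (f (coord_line z l c t))) differentiable (at 0)"
    if "l < m" "c \<in> {1, \<i>}" "z \<in> V" for l c z
    using diff[OF that] h by (rule bounded_linear_pderiv_dir)
  ultimately show ?case using cont by auto
qed

lemma C_diff_add:
  assumes "openin (top_of_set (coord_space m)) V" and "C_diff m V r f" and "C_diff m V r g"
  shows "C_diff m V r (\<lambda>w. f w + g w)"
  using assms(2,3)
proof (induction r arbitrary: f g)
  case 0
  then show ?case by (simp add: continuous_on_add)
next
  case (Suc r)
  have cont: "continuous_on V (\<lambda>w. f w + g w)"
    using Suc.prems by (simp add: continuous_on_add)
  have diff: "(\<lambda>t. f (coord_line z l c t)) differentiable (at 0)"
    "(\<lambda>t. g (coord_line z l c t)) differentiable (at 0)"
    if "l < m" "c \<in> {1, \<i>}" "z \<in> V" for l c z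
    using that Suc.prems by auto
  have "C_diff m V r (pderiv_dir (\<lambda>w. f w + g w) l c)" if lc: "l < m" "c \<in> {1, \<i>}" for l c
    by (rule C_diff_cong[OF assms(1) _ Suc.IH[of "pderiv_dir f l c" "pderiv_dir g l c"]])
      (use lc diff Suc.prems in \<open>auto simp: pderiv_dir_add\<close>)
  then show ?case using cont diff by (auto intro!: differentiable_add)
qed

lemma C_diff_zero: "C_diff m V r (\<lambda>w. 0)"
proof (induction r)
  case (Suc r)
  have "pderiv_dir (\<lambda>w. 0) l c = (\<lambda>w. 0)" for l and c :: complex
    by (rule ext) (simp add: pderiv_dir_def)
  with Suc show ?case by simp
qed simp

lemma smooth_fun_cong:
  assumes "openin (top_of_set (coord_space m)) V" and "\<And>w. w \<in> V \<Longrightarrow> f w = g w"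
    and "smooth_fun m V f"
  shows "smooth_fun m V g"
  using C_diff_cong[OF assms(1), of f g] assms(2,3) unfolding smooth_fun_def by blast

lemma smooth_fun_bounded_linear:
  assumes "openin (top_of_set (coord_space m)) V" and "bounded_linear h" and "smooth_fun m V f"
  shows "smooth_fun m V (\<lambda>w. h (f w))"
  using C_diff_bounded_linear[OF assms(1,2)] assms(3) by (simp add: smooth_fun_def)

lemma smooth_fun_sum:
  assumes "openin (top_of_set (coord_space m)) V" and "\<And>x. x \<in> A \<Longrightarrow> smooth_fun m V (f x)"
  shows "smooth_fun m V (\<lambda>w. \<Sum>x\<in>A. f x w)"
  using assms(2)
proof (induction A rule: infinite_finite_induct)
  case (insert a A)
  then show ?case using C_diff_add[OF assms(1)] by (simp add: smooth_fun_def)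
qed (simp_all add: smooth_fun_def C_diff_zero)

lemma smooth_fun_differentiable:
  assumes "smooth_fun m V f" "l < m" "c \<in> {1, \<i>}" "z \<in> V"
  shows "(\<lambda>t. f (coord_line z l c t)) differentiable (at 0)"
proof -
  have "C_diff m V (Suc 0) f" using assms(1) unfolding smooth_fun_def by blast
  then show ?thesis using assms(2-4) by auto
qed

lemma smooth_fun_pderiv_dir:
  assumes "smooth_fun m V f" "l < m" "c \<in> {1, \<i>}"
  shows "smooth_fun m V (pderiv_dir f l c)"
  unfolding smooth_fun_def
proof
  fix r
  have "C_diff m V (Suc r) f" using assms(1) unfolding smooth_fun_def by blast
  then show "C_diff m V r (pderiv_dir f l c)" using assms(2,3) by auto
qed

lemma smooth_fun_iter_pderiv:
  assumes "smooth_fun m V f" "set ds \<subseteq> {..<m} \<times> {1, \<i>}"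
  shows "smooth_fun m V (iter_pderiv ds f)"
  using assms by (induction ds) (auto intro: smooth_fun_pderiv_dir)

text \<open>Each step differentiates in a real direction and so commutes with conjugation. The
  induction keeps \<open>z\<close> arbitrary because the next derivative needs the equality on all
  of \<open>V\<close>.\<close>

lemma iter_pderiv_cnj:
  assumes "openin (top_of_set (coord_space m)) V" and "smooth_fun m V f"
    and "set ds \<subseteq> {..<m} \<times> {1, \<i>}" and "z \<in> V"
  shows "iter_pderiv ds (\<lambda>w. cnj (f w)) z = cnj (iter_pderiv ds f z)"
  using assms(3,4)
proof (induction ds arbitrary: z)
  case (Cons d ds)
  obtain l c where d: "d = (l, c)" by (cases d)
  with Cons.prems have lc: "l < m" "c \<in> {1, \<i>}" and ds: "set ds \<subseteq> {..<m} \<times> {1, \<i>}" by auto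
  have "pderiv_dir (iter_pderiv ds (\<lambda>w. cnj (f w))) l c z
      = pderiv_dir (\<lambda>w. cnj (iter_pderiv ds f w)) l c z"
    using Cons.IH[OF ds] by (rule pderiv_dir_cong[OF assms(1) Cons.prems(2) lc(1)])
  also have "\<dots> = cnj (pderiv_dir (iter_pderiv ds f) l c z)"
    using smooth_fun_differentiable[OF smooth_fun_iter_pderiv[OF assms(2) ds] lc Cons.prems(2)]
    by (rule bounded_linear_pderiv_dir) (rule bounded_linear_cnj)
  finally show ?case by (simp add: d)
qed simp

text \<open>Conjugation passes through both real partial derivatives and turns the coefficient
  \<open>\<i>\<close> into \<open>-\<i>\<close>, which is the only difference between the two
  operators.\<close>

lemma del_cnj:
  assumes "smooth_fun m V f" "l < m" "z \<in> V"
  shows "del_z l (\<lambda>w. cnj (f w)) z = cnj (del_zbar l f z)"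
    and "del_zbar l (\<lambda>w. cnj (f w)) z = cnj (del_z l f z)"
proof -
  have "pderiv_dir (\<lambda>w. cnj (f w)) l c z = cnj (pderiv_dir f l c z)" if "c \<in> {1, \<i>}" for c
    using smooth_fun_differentiable[OF assms(1,2) that assms(3)]
    by (rule bounded_linear_pderiv_dir) (rule bounded_linear_cnj)
  then show "del_z l (\<lambda>w. cnj (f w)) z = cnj (del_zbar l f z)"
    and "del_zbar l (\<lambda>w. cnj (f w)) z = cnj (del_z l f z)"
    by (simp_all add: del_z_def del_zbar_def)
qed

section \<open>Conjugation of forms\<close>

lemma covec_wedge_cnj: "cnj (covec_wedge as vs) = covec_wedge (map (\<lambda>a v. cnj (a v)) as) vs"
  by (simp add: covec_wedge_def)

text \<open>Permuting the rows of a determinant: reindexing each product by \<rho> replaces \<sigma>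
  by \<sigma> \<circ> \<rho>, whose sign differs by the factor \<open>sign \<rho>\<close>, and
  \<sigma> \<circ> \<rho> again runs over all permutations.\<close>

lemma covec_wedge_permute:
  assumes \<rho>: "\<rho> permutes {..<length as}" and len: "length bs = length as"
    and nth: "\<And>r. r < length as \<Longrightarrow> bs ! r = as ! \<rho> r"
  shows "covec_wedge as vs = of_int (sign \<rho>) * covec_wedge bs vs"
proof -
  let ?A = "{..<length as}"
  let ?g = "\<lambda>\<tau>. of_int (sign \<rho>) * (of_int (sign \<tau>) * (\<Prod>r\<in>?A. (bs ! r) (vs ! \<tau> r)))"
  have "of_int (sign \<sigma>) * (\<Prod>r\<in>?A. (as ! r) (vs ! \<sigma> r)) = ?g (\<sigma> \<circ> \<rho>)"
    if \<sigma>: "\<sigma> permutes ?A" for \<sigma>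
  proof -
    have "(\<Prod>r\<in>?A. (as ! r) (vs ! \<sigma> r)) = (\<Prod>r\<in>?A. (as ! \<rho> r) (vs ! \<sigma> (\<rho> r)))"
      using prod.permute[OF \<rho>, of "\<lambda>r. (as ! r) (vs ! \<sigma> r)"] by (simp add: comp_def)
    also have "\<dots> = (\<Prod>r\<in>?A. (bs ! r) (vs ! (\<sigma> \<circ> \<rho>) r))"
      by (rule prod.cong) (auto simp: nth)
    finally have "(\<Prod>r\<in>?A. (as ! r) (vs ! \<sigma> r)) = (\<Prod>r\<in>?A. (bs ! r) (vs ! (\<sigma> \<circ> \<rho>) r))" .
    moreover have "sign \<rho> * sign (\<sigma> \<circ> \<rho>) = sign \<sigma>"
    proof -
      have "sign (\<sigma> \<circ> \<rho>) = sign \<sigma> * sign \<rho>"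
        using \<sigma> \<rho> permutation_permutes by (blast intro: sign_compose)
      then show ?thesis by (simp add: sign_def)
    qed
    then have "of_int (sign \<sigma>) = (of_int (sign \<rho>) * of_int (sign (\<sigma> \<circ> \<rho>)) :: complex)"
      by (metis of_int_mult)
    ultimately show ?thesis by (simp add: mult.assoc)
  qed
  then have "covec_wedge as vs = (\<Sum>\<sigma> | \<sigma> permutes ?A. ?g (\<sigma> \<circ> \<rho>))"
    unfolding covec_wedge_def by (intro sum.cong) auto
  also have "\<dots> = (\<Sum>\<tau> | \<tau> permutes ?A. ?g \<tau>)"
    by (rule sum_permutations_compose_right[OF \<rho>, symmetric])
  also have "\<dots> = of_int (sign \<rho>) * covec_wedge bs vs"
    unfolding covec_wedge_def len by (rule sum_distrib_left[symmetric])
  finally show ?thesis .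
qed

text \<open>For lists of lengths \<open>a\<close> and \<open>b\<close>, entry \<open>r\<close> of
  \<open>bs @ as\<close> is entry \<open>block_swap a b r\<close> of \<open>as @ bs\<close>. The
  inverse is \<open>block_swap b a\<close>; the sign is left unevaluated below.\<close>

definition block_swap :: "nat \<Rightarrow> nat \<Rightarrow> nat \<Rightarrow> nat" where
  "block_swap a b r = (if r < b then a + r else if r < a + b then r - b else r)"

lemma block_swap_permutes: "block_swap a b permutes {..<a + b}"
proof (rule bij_imp_permutes)
  show "bij_betw (block_swap a b) {..<a + b} {..<a + b}"
    by (rule bij_betw_byWitness[where f' = "block_swap b a"]) (auto simp: block_swap_def)
qed (auto simp: block_swap_def)

lemma covec_wedge_append_swap:
  "covec_wedge (as @ bs) vs =
     of_int (sign (block_swap (length as) (length bs))) * covec_wedge (bs @ as) vs"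
  by (rule covec_wedge_permute)
    (auto simp: block_swap_permutes block_swap_def nth_append)

text \<open>Conjugating each covector puts the antiholomorphic factors of \<open>I\<close> in front
  of the holomorphic ones of \<open>J\<close>; swapping the two blocks restores the normal order at
  the cost of a sign.\<close>

lemma dz_dzbar_cnj:
  assumes "finite I" "finite J"
  shows "cnj (dz_dzbar I J vs) =
    of_int (sign (block_swap (card I) (card J))) * dz_dzbar J I vs"
proof -
  have "cnj (dz_dzbar I J vs) =
      covec_wedge (map (\<lambda>l v. cnj (v l)) (sorted_list_of_set I) @
                   map (\<lambda>l v. v l) (sorted_list_of_set J)) vs"
    by (simp add: dz_dzbar_def covec_wedge_cnj comp_def)
  also have "\<dots> = of_int (sign (block_swap (card I) (card J))) * dz_dzbar J I vs"
    unfolding dz_dzbar_def by (subst covec_wedge_append_swap) simp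
  finally show ?thesis .
qed

lemma local_forms_cnj:
  assumes V: "openin (top_of_set (coord_space m)) V" and "\<eta> \<in> local_forms m V i j"
  shows "(\<lambda>z vs. cnj (\<eta> z vs)) \<in> local_forms m V j i"
proof -
  let ?P = "\<lambda>z vs. z \<in> V \<and> length vs = i + j \<and> set vs \<subseteq> coord_space m"
  let ?S = "\<lambda>i. {I. I \<subseteq> {..<m} \<and> card I = i}"
  \<comment> \<open>The sign depends only on \<open>card I = i\<close> and
    \<open>card J = j\<close>, so one constant serves all index sets and can be absorbed into the
    new coefficients \<open>g J I\<close>.\<close>
  define s :: complex where "s = of_int (sign (block_swap i j))"
  obtain f where f: "\<And>I J. smooth_fun m V (f I J)"
    and \<eta>: "\<eta> = (\<lambda>z vs. if ?P z vs
      then \<Sum>I\<in>?S i. \<Sum>J\<in>?S j. f I J z * dz_dzbar I J vs else 0)"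
    using assms(2) unfolding local_forms_def by blast
  define g where "g = (\<lambda>J I z. s * cnj (f I J z))"
  have "bounded_linear (\<lambda>w. s * cnj w)"
    by (intro bounded_linear_const_mult bounded_linear_cnj)
  then have smooth: "smooth_fun m V (g J I)" for I J
    unfolding g_def using smooth_fun_bounded_linear[OF V] f by blast
  have "cnj (f I J z * dz_dzbar I J vs) = g J I z * dz_dzbar J I vs"
    if "I \<in> ?S i" "J \<in> ?S j" for I J z vs
  proof -
    have "finite I" "finite J" using that by (auto intro: finite_subset)
    then show ?thesis using that by (simp add: dz_dzbar_cnj g_def s_def)
  qed
  then have "cnj (\<Sum>I\<in>?S i. \<Sum>J\<in>?S j. f I J z * dz_dzbar I J vs)
      = (\<Sum>I\<in>?S i. \<Sum>J\<in>?S j. g J I z * dz_dzbar J I vs)" for z vs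
    by (simp only: cnj_sum cong: sum.cong)
  also have "\<And>z vs. \<dots> z vs = (\<Sum>J\<in>?S j. \<Sum>I\<in>?S i. g J I z * dz_dzbar J I vs)"
    by (rule sum.swap)
  finally have "(\<lambda>z vs. cnj (\<eta> z vs)) = (\<lambda>z vs. if z \<in> V \<and> length vs = j + i \<and> set vs \<subseteq> coord_space m
      then \<Sum>J\<in>?S j. \<Sum>I\<in>?S i. g J I z * dz_dzbar J I vs else 0)"
    unfolding \<eta> by (auto simp: fun_eq_iff add.commute)
  with smooth show ?thesis unfolding local_forms_def by blast
qed

text \<open>For a fixed list \<open>vs\<close> each \<open>dz_dzbar I J vs\<close> is a constant, so
  on \<open>V\<close> the value is a finite sum of constant multiples of smooth coefficients, or
  identically zero if \<open>vs\<close> is not admissible.\<close>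

lemma local_forms_smooth:
  assumes V: "openin (top_of_set (coord_space m)) V" and "\<eta> \<in> local_forms m V i j"
  shows "smooth_fun m V (\<lambda>z. \<eta> z vs)"
proof -
  let ?S = "\<lambda>i. {I. I \<subseteq> {..<m} \<and> card I = i}"
  obtain f where f: "\<And>I J. smooth_fun m V (f I J)"
    and \<eta>: "\<eta> = (\<lambda>z vs. if z \<in> V \<and> length vs = i + j \<and> set vs \<subseteq> coord_space m
      then \<Sum>I\<in>?S i. \<Sum>J\<in>?S j. f I J z * dz_dzbar I J vs else 0)"
    using assms(2) unfolding local_forms_def by blast
  show ?thesis
  proof (cases "length vs = i + j \<and> set vs \<subseteq> coord_space m")
    case True
    have "smooth_fun m V (\<lambda>z. \<Sum>I\<in>?S i. \<Sum>J\<in>?S j. f I J z * dz_dzbar I J vs)"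
      using f by (intro smooth_fun_sum[OF V] smooth_fun_bounded_linear[OF V bounded_linear_mult_left])
    then show ?thesis
      by (rule smooth_fun_cong[OF V, rotated]) (use True in \<open>auto simp: \<eta>\<close>)
  next
    case False
    then have "\<eta> z vs = 0" for z
      unfolding \<eta> by (intro if_not_P) blast
    then show ?thesis by (simp add: smooth_fun_def C_diff_zero)
  qed
qed

lemma complex_manifold_open_chart_image:
  assumes "complex_manifold M" "c \<in> atlas M"
  shows "openin (top_of_set (coord_space (cdim M))) (chart_image c)"
  using assms unfolding complex_manifold_def by blast

lemma forms_smooth:
  assumes "complex_manifold M" "\<omega> \<in> forms M i j" "c \<in> atlas M"
  shows "smooth_fun (cdim M) (chart_image c) (\<lambda>z. \<omega> c z vs)"
  using local_forms_smooth[OF complex_manifold_open_chart_image[OF assms(1,3)]] assms(2,3)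
  unfolding forms_def by blast

section \<open>Conjugation of global forms\<close>

lemma form_cnj_form_cnj [simp]: "form_cnj (form_cnj \<omega>) = \<omega>"
  by (simp add: form_cnj_def)

lemma form_cnj_zero: "form_cnj 0 = 0"
  by (simp add: form_cnj_def fun_eq_iff)

lemma form_cnj_add: "form_cnj (\<omega> + \<omega>') = form_cnj \<omega> + form_cnj \<omega>'"
  by (simp add: form_cnj_def fun_eq_iff)

lemma form_cnj_sum: "form_cnj (\<Sum>x\<in>A. f x) = (\<Sum>x\<in>A. form_cnj (f x))"
  by (induction A rule: infinite_finite_induct)
    (simp_all only: sum.infinite sum.empty sum.insert form_cnj_zero form_cnj_add not_False_eq_True)

lemma form_cnj_scale: "form_cnj (form_scale s \<omega>) = form_scale (cnj s) (form_cnj \<omega>)"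
  by (simp add: form_cnj_def form_scale_def)

lemma form_cnj_wedge: "form_cnj (form_wedge a b \<alpha> \<beta>) = form_wedge a b (form_cnj \<alpha>) (form_cnj \<beta>)"
  by (auto simp: form_cnj_def form_wedge_def fun_eq_iff)

lemma form_supp_cnj [simp]: "form_supp M (form_cnj \<omega>) = form_supp M \<omega>"
  by (simp add: form_supp_def form_cnj_def fun_eq_iff)

text \<open>Compatibility between charts equates values on transported tangent vectors. Conjugation
  acts on the values and leaves the vectors alone, so it preserves these equations.\<close>

lemma form_cnj_forms:
  assumes "complex_manifold M" "\<omega> \<in> forms M i j"
  shows "form_cnj \<omega> \<in> forms M j i"
proof -
  have "form_cnj \<omega> c \<in> local_forms (cdim M) (chart_image c) j i" if "c \<in> atlas M" for c
    using local_forms_cnj[OF complex_manifold_open_chart_image[OF assms(1) that]] assms(2) that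
    unfolding forms_def form_cnj_def by blast
  then show ?thesis
    using assms(2) by (auto simp: forms_def form_cnj_def fun_eq_iff)
qed

lemma form_cnj_cforms:
  assumes "complex_manifold M" "\<omega> \<in> cforms M i j"
  shows "form_cnj \<omega> \<in> cforms M j i"
  using assms form_cnj_forms by (auto simp: cforms_def)

text \<open>The converse direction matters because currents are normalised to 0 off the test forms:
  non-test forms must be sent to non-test forms.\<close>

lemma form_cnj_cforms_iff:
  assumes "complex_manifold M"
  shows "form_cnj \<omega> \<in> cforms M j i \<longleftrightarrow> \<omega> \<in> cforms M i j"
  using form_cnj_cforms[OF assms] form_cnj_form_cnj by metis

text \<open>The factor \<open>cnj ((vs ! r) l)\<close> in \<open>form_delbar\<close> becomes
  \<open>(vs ! r) l\<close>, and \<open>del_cnj\<close> exchanges the derivatives; membership in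
  \<open>forms\<close> supplies the smoothness it requires.\<close>

lemma form_del_cnj:
  assumes "complex_manifold M" "\<omega> \<in> forms M i j"
  shows "form_del M (form_cnj \<omega>) = form_cnj (form_delbar M \<omega>)"
proof (intro ext)
  fix c z vs
  show "form_del M (form_cnj \<omega>) c z vs = form_cnj (form_delbar M \<omega>) c z vs"
    using del_cnj(1)[OF forms_smooth[OF assms]]
    by (simp add: form_del_def form_delbar_def form_cnj_def)
qed

lemma form_delbar_cnj:
  assumes "complex_manifold M" "\<omega> \<in> forms M i j"
  shows "form_delbar M (form_cnj \<omega>) = form_cnj (form_del M \<omega>)"
  using form_del_cnj[OF assms(1) form_cnj_forms[OF assms]] by (metis form_cnj_form_cnj)

text \<open>All derivatives involved are conjugated pointwise on \<open>L\<close>, so the supremum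
  is taken over the same set of norms.\<close>

lemma form_seminorm_cnj:
  assumes "complex_manifold M" "\<omega> \<in> forms M i j" "c \<in> atlas M" "L \<subseteq> chart_image c"
  shows "form_seminorm M N c L (form_cnj \<omega>) = form_seminorm M N c L \<omega>"
proof -
  have "norm (iter_pderiv ds (\<lambda>w. form_cnj \<omega> c w vs) z) = norm (iter_pderiv ds (\<lambda>w. \<omega> c w vs) z)"
    if "set ds \<subseteq> {..<cdim M} \<times> {1, \<i>}" "z \<in> L" for ds vs z
    using iter_pderiv_cnj[OF complex_manifold_open_chart_image[OF assms(1,3)]
        forms_smooth[OF assms(1-3)] that(1)] that(2) assms(4)
    by (auto simp: form_cnj_def)
  then show ?thesis
    unfolding form_seminorm_def
    by (intro arg_cong[of _ _ Sup] arg_cong[of _ _ "insert 0"] Collect_cong ex_cong1) auto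
qed

section \<open>Conjugation and integration\<close>

lemma set_lebesgue_integral_cnj: "(LINT x:A|M. cnj (f x)) = cnj (LINT x:A|M. f x)"
  unfolding set_lebesgue_integral_def
  by (simp only: complex_cnj_scaleR[symmetric] Bochner_Integration.integral_cnj)

text \<open>The orienting frame consists of fixed real tangent vectors, which conjugation of the
  values does not touch; hence no orientation sign appears.\<close>

lemma chart_integral_cnj: "chart_integral M c (form_cnj \<eta>) = cnj (chart_integral M c \<eta>)"
  by (simp add: chart_integral_def form_cnj_def set_lebesgue_integral_cnj)

text \<open>Conjugating the pieces keeps their charts and supports, and the top bidegree is
  symmetric.\<close>

lemma form_has_integral_cnj:
  assumes "complex_manifold M" "form_has_integral M \<eta> y"
  shows "form_has_integral M (form_cnj \<eta>) (cnj y)"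
proof -
  obtain r :: nat and cs \<eta>s where
    "\<And>s. s < r \<Longrightarrow> cs s \<in> atlas M \<and> \<eta>s s \<in> cforms M (cdim M) (cdim M) \<and>
       form_supp M (\<eta>s s) \<subseteq> fst (cs s)"
    "\<eta> = (\<Sum>s<r. \<eta>s s)" "y = (\<Sum>s<r. chart_integral M (cs s) (\<eta>s s))"
    using assms(2) unfolding form_has_integral_def by blast
  then show ?thesis
    unfolding form_has_integral_def using form_cnj_cforms[OF assms(1)]
    by (intro exI[of _ r] exI[of _ cs] exI[of _ "\<lambda>s. form_cnj (\<eta>s s)"])
      (simp add: form_cnj_sum chart_integral_cnj)
qed

section \<open>Conjugation of currents\<close>

text \<open>Supports and seminorms are invariant under conjugation, so the same \<open>F\<close>,
  \<open>N\<close> and \<open>C\<close> bound the conjugate functional.\<close>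

lemma form_functional_continuous_cnj:
  assumes M: "complex_manifold M" and T: "form_functional_continuous M i j T"
  shows "form_functional_continuous M j i (\<lambda>\<beta>. cnj (T (form_cnj \<beta>)))"
  unfolding form_functional_continuous_def
proof (intro allI impI)
  fix K assume K: "compactin (pts M) K"
  obtain F N C where FNC: "finite F \<and>
      (\<forall>(c, L)\<in>F. c \<in> atlas M \<and> compact L \<and> L \<subseteq> chart_image c) \<and>
      (\<forall>\<omega>\<in>cforms M i j. form_supp M \<omega> \<subseteq> K \<longrightarrow>
        norm (T \<omega>) \<le> C * (\<Sum>(c, L)\<in>F. form_seminorm M N c L \<omega>))"
    using T[unfolded form_functional_continuous_def, THEN spec, THEN mp, OF K]
    by (elim exE) (rule that)
  then have F: "finite F" "\<forall>(c, L)\<in>F. c \<in> atlas M \<and> compact L \<and> L \<subseteq> chart_image c"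
    and bound: "\<And>\<omega>. \<omega> \<in> cforms M i j \<Longrightarrow> form_supp M \<omega> \<subseteq> K \<Longrightarrow>
      norm (T \<omega>) \<le> C * (\<Sum>(c, L)\<in>F. form_seminorm M N c L \<omega>)"
    by simp_all
  have "norm (cnj (T (form_cnj \<omega>))) \<le> C * (\<Sum>(c, L)\<in>F. form_seminorm M N c L \<omega>)"
    if \<omega>: "\<omega> \<in> cforms M j i" "form_supp M \<omega> \<subseteq> K" for \<omega>
  proof -
    have "(\<Sum>(c, L)\<in>F. form_seminorm M N c L (form_cnj \<omega>)) = (\<Sum>(c, L)\<in>F. form_seminorm M N c L \<omega>)"
      using \<omega>(1) F(2) form_seminorm_cnj[OF M] by (intro sum.cong) (auto simp: cforms_def)
    then show ?thesis
      using bound[OF form_cnj_cforms[OF M \<omega>(1)]] \<omega>(2) by simp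
  qed
  with F show "\<exists>F N C. finite F \<and> (\<forall>(c, L)\<in>F. c \<in> atlas M \<and> compact L \<and> L \<subseteq> chart_image c) \<and>
      (\<forall>\<omega>\<in>cforms M j i. form_supp M \<omega> \<subseteq> K \<longrightarrow>
        norm (cnj (T (form_cnj \<omega>))) \<le> C * (\<Sum>(c, L)\<in>F. form_seminorm M N c L \<omega>))"
    by (intro exI[of _ F] exI[of _ N] exI[of _ C]) simp
qed

lemma form_dual_cnj:
  assumes "complex_manifold M" "T \<in> form_dual M i j"
  shows "(\<lambda>\<beta>. cnj (T (form_cnj \<beta>))) \<in> form_dual M j i"
  using assms form_functional_continuous_cnj[OF assms(1)]
  by (auto simp: form_dual_def form_cnj_cforms_iff form_cnj_add form_cnj_scale)

lemma bidegree_currents_cnj: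
  assumes "complex_manifold M" "T \<in> bidegree_currents M i j"
  shows "(\<lambda>\<beta>. cnj (T (form_cnj \<beta>))) \<in> bidegree_currents M j i"
  using assms form_dual_cnj
  by (auto simp: bidegree_currents_def fun_eq_iff split: if_splits)

text \<open>If \<alpha> represents \<open>T\<close>, then \<open>form_cnj \<alpha>\<close>
  represents the conjugate: conjugating the integral of \<alpha> against
  \<open>form_cnj \<beta>\<close> gives the integral of \<open>form_cnj \<alpha>\<close> against
  \<beta>.\<close>

lemma smooth_currents_cnj:
  assumes M: "complex_manifold M" and T: "T \<in> smooth_currents M i j"
  shows "(\<lambda>\<beta>. cnj (T (form_cnj \<beta>))) \<in> smooth_currents M j i"
proof -
  obtain \<alpha> where \<alpha>: "\<alpha> \<in> forms M i j"
    and int: "\<And>\<beta>. \<beta> \<in> cforms M (cdim M - i) (cdim M - j) \<Longrightarrow> form_has_integral M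
      (form_wedge (i + j) ((cdim M - i) + (cdim M - j)) \<alpha> \<beta>) (T \<beta>)"
    using T unfolding smooth_currents_def by blast
  have "form_has_integral M
      (form_wedge (j + i) ((cdim M - j) + (cdim M - i)) (form_cnj \<alpha>) \<beta>) (cnj (T (form_cnj \<beta>)))"
    if "\<beta> \<in> cforms M (cdim M - j) (cdim M - i)" for \<beta>
    using form_has_integral_cnj[OF M int[OF form_cnj_cforms[OF M that]]]
    by (simp add: form_cnj_wedge add.commute)
  then show ?thesis
    using T bidegree_currents_cnj[OF M] form_cnj_forms[OF M \<alpha>] unfolding smooth_currents_def by blast
qed

section \<open>Conjugation as an involution on currents\<close>

lemma current_cnj_current_cnj [simp]: "current_cnj (current_cnj T) = T"
  by (simp add: current_cnj_def)

lemma current_cnj_add: "current_cnj (S + T) = current_cnj S + current_cnj T"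
  by (simp add: current_cnj_def fun_eq_iff)

lemma current_cnj_diff: "current_cnj (S - T) = current_cnj S - current_cnj T"
  by (simp add: current_cnj_def fun_eq_iff)

lemma current_cnj_proj_fst_lt: "current_cnj (proj_fst_lt p T) = proj_snd_lt p (current_cnj T)"
  by (simp add: current_cnj_def proj_fst_lt_def proj_snd_lt_def fun_eq_iff)

lemma current_cnj_proj_snd_lt: "current_cnj (proj_snd_lt p T) = proj_fst_lt p (current_cnj T)"
  by (simp add: current_cnj_def proj_fst_lt_def proj_snd_lt_def fun_eq_iff)

lemma current_cnj_currents:
  assumes "complex_manifold M" "T \<in> currents M k"
  shows "current_cnj T \<in> currents M k"
proof -
  have "if int i + int j = k then current_cnj T i j \<in> bidegree_currents M i j
        else current_cnj T i j = 0" for i j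
    using assms(2) bidegree_currents_cnj[OF assms(1), of "T j i" j i]
    unfolding currents_def current_cnj_def by (auto simp: add.commute fun_eq_iff)
  then show ?thesis by (simp add: currents_def)
qed

text \<open>Exchanging \<open>i\<close> and \<open>j\<close> exchanges the two summands of the
  differential, and the sign depends only on \<open>i + j\<close>. When \<beta> is not a test form
  of the right bidegree both sides are 0.\<close>

lemma current_d_cnj:
  assumes "complex_manifold M"
  shows "current_d M (current_cnj T) = current_cnj (current_d M T)"
proof (intro ext)
  fix i j \<beta>
  have forms: "\<beta> \<in> forms M (cdim M - i) (cdim M - j)"
    if "\<beta> \<in> cforms M (cdim M - i) (cdim M - j)"
    using that by (simp add: cforms_def)
  show "current_d M (current_cnj T) i j \<beta> = current_cnj (current_d M T) i j \<beta>"
    using form_del_cnj[OF assms forms] form_delbar_cnj[OF assms forms]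
    by (auto simp: current_d_def current_cnj_def form_cnj_cforms_iff[OF assms] add.commute)
qed

text \<open>Components outside the range of bidegrees vanish, and on the others the series that represents
  an integral current has real multiplicities.\<close>

lemma integral_currents_cnj:
  assumes M: "complex_manifold M" and T: "T \<in> integral_currents M k"
  shows "current_cnj T = T"
proof (intro ext)
  fix i j \<beta>
  let ?m = "cdim M" and ?n = "2 * cdim M - k"
  have curr: "if int i + int j = int k then T i j \<in> bidegree_currents M i j else T i j = 0" for i j
    using T by (simp add: integral_currents_def currents_def)
  show "current_cnj T i j \<beta> = T i j \<beta>"
  proof (cases "i \<le> ?m \<and> j \<le> ?m \<and> i + j = k \<and> \<beta> \<in> cforms M (?m - i) (?m - j)")
    case True
    have "locally_rectifiable M k T" using T by (simp add: integral_currents_def)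
    then obtain c :: "nat \<Rightarrow> 'a chart" and B :: "nat \<Rightarrow> (nat \<Rightarrow> real) set" and g and \<theta> :: "nat \<Rightarrow> int"
      where "\<forall>i\<le>?m. \<forall>j\<le>?m. i + j = k \<longrightarrow> (\<forall>\<beta>\<in>cforms M (?m - i) (?m - j).
        (\<lambda>l. of_int (\<theta> l) *
           (LINT y : B l | coord_measure ?n. \<beta> (c l) (g l y) (tangent_vecs ?n (g l) y)))
        sums T i j \<beta>)"
      unfolding locally_rectifiable_def Let_def by (elim exE conjE) (rule that)
    then have sums: "(\<lambda>l. of_int (\<theta> l) *
           (LINT y : B l | coord_measure ?n. \<beta> (c l) (g l y) (tangent_vecs ?n (g l) y)))
        sums T i j \<beta>"
      if "i \<le> ?m" "j \<le> ?m" "i + j = k" "\<beta> \<in> cforms M (?m - i) (?m - j)" for i j \<beta>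
      using that by blast
    let ?I = "\<lambda>\<beta> l. (LINT y : B l | coord_measure ?n. \<beta> (c l) (g l y) (tangent_vecs ?n (g l) y))"
    \<comment> \<open>One family of Lipschitz pieces represents all components at once. The series
      of component \<open>(j, i)\<close> at \<open>form_cnj \<beta>\<close> is therefore, term by
      term, conjugate to that of \<open>(i, j)\<close> at \<beta>, and limits are unique.\<close>
    have "(\<lambda>l. cnj (of_int (\<theta> l) * ?I (form_cnj \<beta>) l)) sums cnj (T j i (form_cnj \<beta>))"
      using sums[of j i "form_cnj \<beta>"] True form_cnj_cforms[OF M]
      by (simp only: sums_cnj add.commute)
    moreover have "cnj (of_int (\<theta> l) * ?I (form_cnj \<beta>) l) = of_int (\<theta> l) * ?I \<beta> l" for l
      by (simp add: form_cnj_def set_lebesgue_integral_cnj)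
    ultimately have "(\<lambda>l. of_int (\<theta> l) * ?I \<beta> l) sums cnj (T j i (form_cnj \<beta>))"
      by (simp only:)
    then show ?thesis
      using sums[of i j \<beta>] True sums_unique2 unfolding current_cnj_def by blast
  next
    case False
    \<comment> \<open>Stated for all \<open>i\<close>, \<open>j\<close>, \<beta>, since it is used
      both at \<beta> and, with the bidegree exchanged, at \<open>form_cnj \<beta>\<close>.\<close>
    have zero: "T i j \<beta> = 0"
      if "\<not> (i \<le> ?m \<and> j \<le> ?m \<and> i + j = k \<and> \<beta> \<in> cforms M (?m - i) (?m - j))" for i j \<beta>
    proof (cases "i + j = k")
      case True
      then have "T i j \<in> bidegree_currents M i j" using curr[of i j] by simp
      then show ?thesis
        using that True by (auto simp: bidegree_currents_def form_dual_def split: if_splits)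
    next
      case False
      then have "int i + int j \<noteq> int k" by linarith
      then show ?thesis using curr[of i j] by simp
    qed
    have "T j i (form_cnj \<beta>) = 0"
      using False by (intro zero) (auto simp: form_cnj_cforms_iff[OF M] add.commute)
    then show ?thesis using zero[OF False] by (simp add: current_cnj_def)
  qed
qed

section \<open>Conjugation of sparks\<close>

text \<open>The components trade places because conjugation turns the truncation
  \<open>i < p\<close> into \<open>j < p\<close>. Acting on pairs allows the spark equations to be
  conjugated as a whole.\<close>

definition pair_cnj :: "'a current \<times> 'a current \<Rightarrow> 'a current \<times> 'a current"
  where "pair_cnj = (\<lambda>(a, b). (current_cnj b, current_cnj a))"

lemma pair_cnj_add: "pair_cnj (x + y) = pair_cnj x + pair_cnj y"
  by (cases x; cases y) (simp add: pair_cnj_def current_cnj_add)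

lemma pair_cnj_diff: "pair_cnj (x - y) = pair_cnj x - pair_cnj y"
  by (cases x; cases y) (simp add: pair_cnj_def current_cnj_diff)

lemma pair_cnj_trunc_currents:
  assumes "complex_manifold M" "x \<in> trunc_currents M k p q"
  shows "pair_cnj x \<in> trunc_currents M k q p"
  using assms current_cnj_currents[OF assms(1)]
  by (auto simp: trunc_currents_def pair_cnj_def current_cnj_proj_fst_lt current_cnj_proj_snd_lt)

lemma pair_cnj_trunc_d:
  assumes "complex_manifold M"
  shows "pair_cnj (trunc_d M p q x) = trunc_d M q p (pair_cnj x)"
  by (cases x) (simp add: pair_cnj_def trunc_d_def current_cnj_proj_fst_lt
      current_cnj_proj_snd_lt current_d_cnj[OF assms])

lemma pair_cnj_trunc_forms:
  assumes "complex_manifold M" "x \<in> trunc_forms M k p q"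
  shows "pair_cnj x \<in> trunc_forms M k q p"
proof -
  obtain a b where x: "x = (a, b)" by (cases x)
  have "current_cnj a i j \<in> smooth_currents M i j" "current_cnj b i j \<in> smooth_currents M i j" for i j
    using assms(2) smooth_currents_cnj[OF assms(1)]
    by (auto simp: x trunc_forms_def current_cnj_def)
  then show ?thesis
    using pair_cnj_trunc_currents[OF assms(1), of x k p q] assms(2)
    by (auto simp: x trunc_forms_def pair_cnj_def)
qed

text \<open>Integral currents are fixed by conjugation, which is why a spark keeps its third
  entry.\<close>

lemma pair_cnj_Psi:
  assumes "complex_manifold M" "r \<in> integral_currents M k"
  shows "pair_cnj (Psi p q r) = Psi q p r"
  using integral_currents_cnj[OF assms]
  by (simp add: pair_cnj_def Psi_def current_cnj_proj_fst_lt current_cnj_proj_snd_lt)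

lemma spark_cnj_spark_cnj [simp]: "spark_cnj (spark_cnj x) = x"
  by (cases x) (simp add: spark_cnj_def)

lemma spark_cnj_add: "spark_cnj (x + y) = spark_cnj x + spark_cnj y"
  by (cases x; cases y) (simp add: spark_cnj_def current_cnj_add)

lemma spark_cnj_sparks:
  assumes M: "complex_manifold M" and "x \<in> sparks M k p q"
  shows "spark_cnj x \<in> sparks M k q p"
proof -
  obtain a b r e where x: "x = (a, b, r)" and ab: "(a, b) \<in> trunc_currents M (int k) p q"
    and r: "r \<in> integral_currents M (k + 1)" "current_d M r = 0"
    and e: "e \<in> trunc_forms M (int k + 1) p q" "trunc_d M p q (a, b) = e - Psi p q r"
    using assms(2) unfolding sparks_def by blast
  have "trunc_d M q p (pair_cnj (a, b)) = pair_cnj e - Psi q p r"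
    using e(2) pair_cnj_trunc_d[OF M, of p q "(a, b)"] pair_cnj_Psi[OF M r(1)]
    by (simp add: pair_cnj_diff)
  then show ?thesis
    using pair_cnj_trunc_currents[OF M ab] pair_cnj_trunc_forms[OF M e(1)] r
    by (auto simp: x sparks_def spark_cnj_def pair_cnj_def)
qed

text \<open>The witness \<open>c\<close> is replaced by its conjugate, while the integral current
  \<open>s\<close> stays, so the equation for \<open>r - r'\<close> is unchanged.\<close>

lemma spark_cnj_spark_rel:
  assumes M: "complex_manifold M" and "(x, y) \<in> spark_rel M k p q"
  shows "(spark_cnj x, spark_cnj y) \<in> spark_rel M k q p"
proof -
  obtain a b r a' b' r' c s where xy: "x = (a, b, r)" "y = (a', b', r')"
    and sp: "x \<in> sparks M k p q" "y \<in> sparks M k p q"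
    and c: "c \<in> trunc_currents M (int k - 1) p q" and s: "s \<in> integral_currents M k"
    and eq: "(a, b) - (a', b') = trunc_d M p q c + Psi p q s" "r - r' = - current_d M s"
    using assms(2) unfolding spark_rel_def by blast
  have "pair_cnj (a, b) - pair_cnj (a', b') = trunc_d M q p (pair_cnj c) + Psi q p s"
    using arg_cong[OF eq(1), of pair_cnj]
    by (simp only: pair_cnj_diff pair_cnj_add pair_cnj_trunc_d[OF M] pair_cnj_Psi[OF M s])
  then have "\<exists>c\<in>trunc_currents M (int k - 1) q p. \<exists>s\<in>integral_currents M k.
      pair_cnj (a, b) - pair_cnj (a', b') = trunc_d M q p c + Psi q p s \<and>
      r - r' = - current_d M s"
    using pair_cnj_trunc_currents[OF M c] s eq(2) by blast
  then show ?thesis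
    using spark_cnj_sparks[OF M sp(1)] spark_cnj_sparks[OF M sp(2)]
    by (simp add: xy spark_rel_def spark_cnj_def pair_cnj_def)
qed

section \<open>Conjugation of spark classes\<close>

lemma spark_cnj_image_sparks:
  assumes "complex_manifold M"
  shows "spark_cnj ` sparks M k p q = sparks M k q p"
  using spark_cnj_sparks[OF assms] by (auto simp: image_iff) (metis spark_cnj_spark_cnj)

text \<open>The second inclusion is the first with \<open>p\<close> and \<open>q\<close> exchanged,
  combined with involutivity. Full equality lets the induced map be defined as taking images, with
  no choice of representatives.\<close>

lemma spark_cnj_image_class:
  assumes "complex_manifold M"
  shows "spark_cnj ` spark_class M k p q x = spark_class M k q p (spark_cnj x)"
proof
  show "spark_cnj ` spark_class M k p q x \<subseteq> spark_class M k q p (spark_cnj x)"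
    using spark_cnj_spark_rel[OF assms] by (auto simp: spark_class_def)
  show "spark_class M k q p (spark_cnj x) \<subseteq> spark_cnj ` spark_class M k p q x"
  proof
    fix y assume "y \<in> spark_class M k q p (spark_cnj x)"
    then have "spark_cnj y \<in> spark_class M k p q x"
      using spark_cnj_spark_rel[OF assms, of "spark_cnj x" y k q p] by (simp add: spark_class_def)
    then show "y \<in> spark_cnj ` spark_class M k p q x"
      by (metis image_eqI spark_cnj_spark_cnj)
  qed
qed

lemma spark_group_carrier: "carrier (spark_group M k p q) = spark_class M k p q ` sparks M k p q"
  by (auto simp: spark_group_def spark_class_def quotient_def)

lemma spark_cnj_image_iso:
  assumes "complex_manifold M"
  shows "(`) spark_cnj \<in> iso (spark_group M k p q) (spark_group M k q p)"
proof (rule isoI)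
  have carrier: "(`) spark_cnj ` carrier (spark_group M k p q) = carrier (spark_group M k q p)"
    by (simp add: spark_group_carrier image_image spark_cnj_image_class[OF assms]
        flip: spark_cnj_image_sparks[OF assms, of k p q])
  \<comment> \<open>Products are unions of classes of sums; images commute with unions and
    \<open>spark_cnj\<close> is additive, so this holds for arbitrary sets of sparks.\<close>
  have mult: "spark_cnj ` (S \<otimes>\<^bsub>spark_group M k p q\<^esub> S') =
      spark_cnj ` S \<otimes>\<^bsub>spark_group M k q p\<^esub> spark_cnj ` S'" for S S'
    by (simp add: spark_group_def image_UN spark_cnj_image_class[OF assms] spark_cnj_add)
  show "(`) spark_cnj \<in> hom (spark_group M k p q) (spark_group M k q p)"
    using carrier mult by (auto simp: hom_def)
  have "inj_on ((`) spark_cnj) A" for A :: "'a spark set set"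
    by (rule inj_on_inverseI[where g = "(`) spark_cnj"]) (simp add: image_image)
  then show "bij_betw ((`) spark_cnj) (carrier (spark_group M k p q)) (carrier (spark_group M k q p))"
    using carrier by (simp add: bij_betw_def)
qed

theorem proposition2p5:
  fixes X :: "'a charted_space" and p q k :: nat
  assumes "complex_manifold X"
  shows "spark_cnj ` sparks X k p q \<subseteq> sparks X k q p \<and>
    (\<forall>x y. (x, y) \<in> spark_rel X k p q \<longrightarrow> (spark_cnj x, spark_cnj y) \<in> spark_rel X k q p) \<and>
    (\<exists>h \<in> iso (spark_group X k p q) (spark_group X k q p).
       \<forall>x \<in> sparks X k p q. h (spark_class X k p q x) = spark_class X k q p (spark_cnj x))"
proof (intro conjI allI impI bexI ballI)
  show "spark_cnj ` sparks X k p q \<subseteq> sparks X k q p"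
    by (simp add: spark_cnj_image_sparks[OF assms])
  show "(spark_cnj x, spark_cnj y) \<in> spark_rel X k q p" if "(x, y) \<in> spark_rel X k p q" for x y
    using that by (rule spark_cnj_spark_rel[OF assms])
  show "spark_cnj ` spark_class X k p q x = spark_class X k q p (spark_cnj x)" for x
    by (rule spark_cnj_image_class[OF assms])
  show "(`) spark_cnj \<in> iso (spark_group X k p q) (spark_group X k q p)"
    by (rule spark_cnj_image_iso[OF assms])
qed

end
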